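(* Let $\mu,\gamma>0$, let $\sigma:\mathbb{R}\to[0,\infty)$ be smooth, and assume there is a constant $C_1>0$ with $\sigma(a)\ge C_1$ for all $a\in\mathbb{R}$. Let $(u,\alpha)$ be a solution of system (S) (see context) and let $v:=\sqrt{1+u_x^2}$. Then for all $0<x_0<1$ and $t_0>0$, $$v(x_0,t_0)\le\frac{\sigma(\alpha(0))}{C_1}\sup_{0<x<1}v^2(x,0).$$
   Context: System (S): let $\mathbb{T}=\mathbb{R}/\mathbb{Z}$; the unknowns are $u:\mathbb{T}\times[0,\infty)\to\mathbb{R}$ and $\alpha:[0,\infty)\to\mathbb{R}$ satisfying $$\frac{u_t}{\sqrt{1+u_x^2}}=\mu\sigma(\alpha)\Bigl(\frac{u_x}{\sqrt{1+u_x^2}}\Bigr)_x\ (x\in\mathbb{T},\,t>0),\qquad \alpha_t=-\gamma\,\sigma_\alpha(\alpha)\,|\Gamma_t|\ (t>0),\qquad u(x,0)=u_0(x),\ \alpha(0)=\alpha_0,$$ where $\sigma_\alpha$ is the derivative of $\sigma$ and $|\Gamma_t|=\int_0^1\sqrt{1+u_x^2}\,dx$. A solution is a sufficiently smooth classical solution (smooth up to $t=0$). *)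

theory Defs
  imports "HOL-Analysis.Analysis" "HOL-Library.Periodic_Fun"
begin

definition smooth :: "(real \<Rightarrow> real) \<Rightarrow> bool" where
  "smooth f \<longleftrightarrow> (\<forall>n x. (deriv ^^ n) f differentiable (at x))"

text \<open>
  A function on \<open>\<T> \<times> [0,\<infinity>)\<close> is rendered as \<open>u :: real \<Rightarrow> real \<Rightarrow> real\<close> (space first, then time),
  with \<open>u x t\<close> constrained only for \<open>t \<ge> 0\<close> and 1-periodic in \<open>x\<close>.
\<close>

definition dx :: "(real \<Rightarrow> real \<Rightarrow> real) \<Rightarrow> real \<Rightarrow> real \<Rightarrow> real" where
  "dx u x t = deriv (\<lambda>y. u y t) x"

text \<open>
  The ordinary derivative for \<open>t > 0\<close> and the one-sided derivative at \<open>t = 0\<close>.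
\<close>

definition ddt :: "(real \<Rightarrow> real) \<Rightarrow> real \<Rightarrow> real" where
  "ddt f t = vector_derivative f (at t within {0..})"

definition gradient_function :: "(real \<Rightarrow> real \<Rightarrow> real) \<Rightarrow> real \<Rightarrow> real \<Rightarrow> real" where
  "gradient_function u x t = sqrt (1 + (dx u x t)\<^sup>2)"

definition curve_length :: "(real \<Rightarrow> real \<Rightarrow> real) \<Rightarrow> real \<Rightarrow> real" where
  "curve_length u t = integral {0..1} (\<lambda>x. sqrt (1 + (dx u x t)\<^sup>2))"

text \<open>
  The regularity of a classical solution, up to \<open>t = 0\<close>: \<open>u\<close>, \<open>u\<^sub>t\<close>, \<open>u\<^sub>x\<close>, \<open>u\<^sub>x\<^sub>x\<close> exist and
  are continuous on \<open>\<T> \<times> [0,\<infinity>)\<close>, and \<open>\<alpha>\<close> is continuously differentiable on \<open>[0,\<infinity>)\<close>.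
  This is the least regularity for which every term of the system is a continuous function;
  solutions of any higher smoothness class are covered.
\<close>

definition classical_regularity :: "(real \<Rightarrow> real \<Rightarrow> real) \<Rightarrow> (real \<Rightarrow> real) \<Rightarrow> bool" where
  "classical_regularity u \<alpha> \<longleftrightarrow>
     (\<forall>t\<ge>0. \<forall>x. (\<lambda>y. u y t) differentiable (at x)) \<and>
     (\<forall>t\<ge>0. \<forall>x. (\<lambda>y. dx u y t) differentiable (at x)) \<and>
     (\<forall>t\<ge>0. \<forall>x. (\<lambda>s. u x s) differentiable (at t within {0..})) \<and>
     continuous_on (UNIV \<times> {0..}) (\<lambda>(x, t). u x t) \<and>
     continuous_on (UNIV \<times> {0..}) (\<lambda>(x, t). dx u x t) \<and>
     continuous_on (UNIV \<times> {0..}) (\<lambda>(x, t). dx (dx u) x t) \<and>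
     continuous_on (UNIV \<times> {0..}) (\<lambda>(x, t). ddt (u x) t) \<and>
     (\<forall>t\<ge>0. \<alpha> differentiable (at t within {0..})) \<and>
     continuous_on {0..} (ddt \<alpha>)"

definition solves_system ::
  "real \<Rightarrow> real \<Rightarrow> (real \<Rightarrow> real) \<Rightarrow> (real \<Rightarrow> real) \<Rightarrow> real \<Rightarrow>
   (real \<Rightarrow> real \<Rightarrow> real) \<Rightarrow> (real \<Rightarrow> real) \<Rightarrow> bool" where
  "solves_system \<mu> \<gamma> \<sigma> u\<^sub>0 \<alpha>\<^sub>0 u \<alpha> \<longleftrightarrow>
     (\<forall>t\<ge>0. periodic_fun_simple' (\<lambda>x. u x t)) \<and>
     classical_regularity u \<alpha> \<and>
     (\<forall>x. \<forall>t>0. ddt (u x) t / sqrt (1 + (dx u x t)\<^sup>2) =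
        \<mu> * \<sigma> (\<alpha> t) * dx (\<lambda>y s. dx u y s / sqrt (1 + (dx u y s)\<^sup>2)) x t) \<and>
     (\<forall>t>0. ddt \<alpha> t = - \<gamma> * deriv \<sigma> (\<alpha> t) * curve_length u t) \<and>
     (\<forall>x. u x 0 = u\<^sub>0 x) \<and>
     \<alpha> 0 = \<alpha>\<^sub>0"

end

theory Submission
  imports Defs
begin

text \<open>
  Since \<open>\<sigma>(\<alpha>(t)) > 0\<close>, the first equation reads \<open>u\<^sub>t = \<mu> \<sigma>(\<alpha>) u\<^sub>x\<^sub>x / (1 + u\<^sub>x\<^sup>2)\<close>, which is parabolic
  and invariant under translations in \<open>x\<close>. Comparing \<open>u\<close> with its translate by \<open>h\<close> shows that
  the maximum over \<open>x\<close> of \<open>u(x + h, t) - u(x, t)\<close> does not increase in \<open>t\<close>, which requires no third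
  derivatives of \<open>u\<close>. Letting \<open>h \<rightarrow> 0\<close>, \<open>\<bar>u\<^sub>x\<bar>\<close>, and hence \<open>v\<close>, is bounded by its initial supremum.
  The bound of the theorem is weaker, as \<open>v \<ge> 1\<close> and \<open>\<sigma>(\<alpha>(0)) \<ge> C\<^sub>1\<close>.
\<close>

section \<open>One-variable calculus at a maximum\<close>

text \<open>If \<open>c\<close> were positive, \<open>f'\<close> would be positive just to the right
  of its zero \<open>x\<close>, and the mean value theorem would make \<open>f\<close> exceed its
  maximum there. Differentiability of \<open>f'\<close> at the single point \<open>x\<close>
  suffices.\<close>

lemma second_derivative_nonpos_at_max:
  fixes f f' :: "real \<Rightarrow> real"
  assumes f: "\<And>y. (f has_real_derivative f' y) (at y)"
    and f': "(f' has_real_derivative c) (at x)"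
    and max: "\<And>y. f y \<le> f x"
  shows "f' x = 0" and "c \<le> 0"
proof -
  show zero: "f' x = 0"
    using DERIV_local_max[OF f, of 1 x] max by auto
  show "c \<le> 0"
  proof (rule ccontr)
    assume "\<not> c \<le> 0"
    then obtain d where d: "d > 0" "\<And>h. 0 < h \<Longrightarrow> h < d \<Longrightarrow> f' x < f' (x + h)"
      using DERIV_pos_inc_right[OF f'] by auto
    obtain z where z: "x < z" "z < x + d / 2" "f (x + d / 2) - f x = (x + d / 2 - x) * f' z"
      using MVT2[of x "x + d / 2" f f'] f d(1) by auto
    have "f' z > 0"
      using d(2)[of "z - x"] z d(1) zero by auto
    then have "f (x + d / 2) > f x"
      using z(3) d(1) by (metis add_diff_cancel_left' diff_gt_0_iff_gt half_gt_zero mult_pos_pos)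
    then show False
      using max[of "x + d / 2"] by simp
  qed
qed

text \<open>Serves for the time variable: the maximum over a time interval may sit at its right end,
  where only earlier times can be compared and only a sign of the derivative results.\<close>

lemma derivative_nonneg_at_left_max:
  fixes f :: "real \<Rightarrow> real"
  assumes f: "(f has_real_derivative c) (at t)"
    and "a < t" and max: "\<And>s. a \<le> s \<Longrightarrow> s \<le> t \<Longrightarrow> f s \<le> f t"
  shows "c \<ge> 0"
proof (rule ccontr)
  assume "\<not> c \<ge> 0"
  then obtain d where d: "d > 0" "\<And>h. 0 < h \<Longrightarrow> h < d \<Longrightarrow> f t < f (t - h)"
    using DERIV_neg_dec_left[OF f] by auto
  \<comment> \<open>Small enough both for the strict decrease, valid for steps below
    \<open>d\<close>, and for \<open>t - h\<close> to stay in the interval.\<close>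
  define h where "h = min (d / 2) (t - a)"
  have "0 < h" "h < d" "a \<le> t - h"
    using d(1) \<open>a < t\<close> by (auto simp: h_def)
  then show False
    using d(2)[of h] max[of "t - h"] by auto
qed

section \<open>Periodicity and compactness\<close>

lemma periodic_eq_frac:
  fixes f :: "real \<Rightarrow> 'a"
  assumes "periodic_fun_simple' f"
  shows "f x = f (frac x)"
proof -
  interpret periodic_fun_simple' f by fact
  show ?thesis
    using plus_of_int[of "frac x" "\<lfloor>x\<rfloor>"] by (simp add: frac_def)
qed

text \<open>Replacing \<open>y\<close> by \<open>frac y\<close> moves every point of the unbounded
  strip into the compact rectangle \<open>{0..1} \<times> {0..T}\<close>, where a continuous
  function has a maximum.\<close>

lemma periodic_attains_max:
  fixes F :: "real \<Rightarrow> real \<Rightarrow> real"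
  assumes cont: "continuous_on (UNIV \<times> {0..}) (\<lambda>(x, t). F x t)"
    and per: "\<And>t. t \<ge> 0 \<Longrightarrow> periodic_fun_simple' (\<lambda>x. F x t)" and "T \<ge> 0"
  shows "\<exists>x. \<exists>t\<in>{0..T}. \<forall>y. \<forall>s\<in>{0..T}. F y s \<le> F x t"
proof -
  have "continuous_on ({0..1} \<times> {0..T}) (\<lambda>(x, t). F x t)"
    by (rule continuous_on_subset[OF cont]) auto
  moreover have "compact ({0..1::real} \<times> {0..T})" and "{0..1::real} \<times> {0..T} \<noteq> {}"
    using \<open>T \<ge> 0\<close> by (auto intro: compact_Times)
  ultimately have "\<exists>p\<in>{0..1} \<times> {0..T}. \<forall>q\<in>{0..1} \<times> {0..T}. (\<lambda>(x, t). F x t) q \<le> (\<lambda>(x, t). F x t) p"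
    by (intro continuous_attains_sup)
  then obtain p where p: "p \<in> {0..1} \<times> {0..T}"
    "\<forall>q\<in>{0..1} \<times> {0..T}. (\<lambda>(x, t). F x t) q \<le> (\<lambda>(x, t). F x t) p"
    by (elim bexE)
  obtain x t where xt: "p = (x, t)" by (cases p)
  have "F y s \<le> F x t" if s: "s \<in> {0..T}" for y s
  proof -
    have "frac y \<in> {0..1}"
      using frac_ge_0[of y] frac_lt_1[of y] by auto
    then show ?thesis
      using bspec[OF p(2), of "(frac y, s)"] s xt periodic_eq_frac[OF per, of s y] by auto
  qed
  then show ?thesis
    using p(1) xt by blast
qed

section \<open>The curvature term and comparison with translates\<close>

text \<open>The derivative of z / sqrt (1 + z^2) is (1 + z^2)^(-3/2). The power is split so that one
  square root cancels against the left side of the evolution equation.\<close>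

lemma curvature_term_derivative:
  fixes g :: "real \<Rightarrow> real"
  assumes "(g has_real_derivative c) (at x)"
  shows "((\<lambda>y. g y / sqrt (1 + (g y)\<^sup>2)) has_real_derivative
    c / (sqrt (1 + (g x)\<^sup>2) * (1 + (g x)\<^sup>2))) (at x)"
proof -
  define v where "v = sqrt (1 + (g x)\<^sup>2)"
  have pos: "1 + (g x)\<^sup>2 > 0" by (simp add: add_pos_nonneg)
  have v: "v > 0" "v\<^sup>2 = 1 + (g x)\<^sup>2" using pos by (auto simp: v_def)
  have "((\<lambda>y. g y / sqrt (1 + (g y)\<^sup>2)) has_real_derivative
      (c * v - g x * (2 * g x * c * (inverse v / 2))) / (v * v)) (at x)"
    unfolding v_def using pos assms
    by (auto intro!: derivative_eq_intros simp: power2_eq_square)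
  also have "(c * v - g x * (2 * g x * c * (inverse v / 2))) / (v * v)
      = c * (v\<^sup>2 - (g x)\<^sup>2) / (v * v\<^sup>2)"
    using v(1) by (simp add: field_simps power2_eq_square)
  also have "\<dots> = c / (v * (1 + (g x)\<^sup>2))"
    by (simp add: v(2))
  finally show ?thesis by (simp add: v_def)
qed

text \<open>The coefficient \<open>K\<close> sees \<open>x\<close> only through the slope, so the
  translate solves the same equation. Where the difference is maximal in \<open>x\<close> the two
  slopes agree, hence so do the coefficients, and only \<open>K\<close> times a nonpositive second
  derivative remains.\<close>

lemma translation_difference_le:
  fixes u :: "real \<Rightarrow> real \<Rightarrow> real" and K :: "real \<Rightarrow> real \<Rightarrow> real"
  assumes cont: "continuous_on (UNIV \<times> {0..}) (\<lambda>(x, t). u x t)"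
    and per: "\<And>t. t \<ge> 0 \<Longrightarrow> periodic_fun_simple' (\<lambda>x. u x t)"
    and ux: "\<And>x t. t > 0 \<Longrightarrow> ((\<lambda>y. u y t) has_real_derivative p x t) (at x)"
    and uxx: "\<And>x t. t > 0 \<Longrightarrow> ((\<lambda>y. p y t) has_real_derivative q x t) (at x)"
    and ut: "\<And>x t. t > 0 \<Longrightarrow> (u x has_real_derivative K t (p x t) * q x t) (at t)"
    and K: "\<And>t z. t > 0 \<Longrightarrow> K t z \<ge> 0"
    and init: "\<And>x. u (x + h) 0 - u x 0 \<le> B" and "T \<ge> 0"
  shows "u (x + h) T - u x T \<le> B"
proof (rule field_le_epsilon)
  fix e :: real assume "e > 0"
  \<comment> \<open>Subtracting \<open>\<epsilon> * t\<close> below makes the time derivative at a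
    spatial maximum strictly negative. Dividing by \<open>T + 1\<close> rather than \<open>T\<close>
    covers \<open>T = 0\<close>.\<close>
  define \<epsilon> where "\<epsilon> = e / (T + 1)"
  have \<epsilon>: "\<epsilon> > 0" "\<epsilon> * T \<le> e"
    using \<open>e > 0\<close> \<open>T \<ge> 0\<close> by (auto simp: \<epsilon>_def field_simps)
  define F where "F x t = u (x + h) t - u x t - \<epsilon> * t" for x t
  have shift: "continuous_on (UNIV \<times> {0..}) (\<lambda>(x, t). u (x + h) t)"
  proof -
    have "continuous_on (UNIV \<times> {0..}) ((\<lambda>(x, t). u x t) \<circ> (\<lambda>(x, t). (x + h, t)))"
      by (intro continuous_on_compose continuous_on_subset[OF cont])
        (auto intro!: continuous_intros simp: case_prod_unfold)
    then show ?thesis by (simp add: o_def case_prod_unfold)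
  qed
  have contF: "continuous_on (UNIV \<times> {0..}) (\<lambda>(x, t). F x t)"
    using shift cont unfolding F_def case_prod_unfold by (intro continuous_intros)
  have perF: "periodic_fun_simple' (\<lambda>x. F x t)" if "t \<ge> 0" for t
  proof -
    interpret periodic_fun_simple' "\<lambda>x. u x t" using per[OF that] .
    have "x + 1 + h = (x + h) + 1" for x :: real by simp
    then show ?thesis
      by unfold_locales (simp only: F_def plus_1)
  qed
  obtain x\<^sub>m t\<^sub>m where m: "0 \<le> t\<^sub>m" "t\<^sub>m \<le> T"
    "\<And>y s. 0 \<le> s \<Longrightarrow> s \<le> T \<Longrightarrow> F y s \<le> F x\<^sub>m t\<^sub>m"
    using periodic_attains_max[of F, OF contF perF \<open>T \<ge> 0\<close>] by fastforce
  have "t\<^sub>m = 0"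
  proof (rule ccontr)
    assume "t\<^sub>m \<noteq> 0"
    with m have t: "t\<^sub>m > 0" by simp
    have Fx: "((\<lambda>y. F y t\<^sub>m) has_real_derivative p (y + h) t\<^sub>m - p y t\<^sub>m) (at y)" for y
      unfolding F_def using DERIV_shift[of "\<lambda>y. u y t\<^sub>m"] ux[OF t]
      by (auto intro!: derivative_eq_intros)
    have Fxx: "((\<lambda>y. p (y + h) t\<^sub>m - p y t\<^sub>m) has_real_derivative
        q (x\<^sub>m + h) t\<^sub>m - q x\<^sub>m t\<^sub>m) (at x\<^sub>m)"
      using DERIV_shift[of "\<lambda>y. p y t\<^sub>m"] uxx[OF t] by (auto intro!: derivative_eq_intros)
    have *: "p (x\<^sub>m + h) t\<^sub>m - p x\<^sub>m t\<^sub>m = 0" "q (x\<^sub>m + h) t\<^sub>m - q x\<^sub>m t\<^sub>m \<le> 0"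
      using second_derivative_nonpos_at_max[OF Fx Fxx] m by auto
    have "(F x\<^sub>m has_real_derivative
        K t\<^sub>m (p (x\<^sub>m + h) t\<^sub>m) * q (x\<^sub>m + h) t\<^sub>m - K t\<^sub>m (p x\<^sub>m t\<^sub>m) * q x\<^sub>m t\<^sub>m - \<epsilon>) (at t\<^sub>m)"
      unfolding F_def using ut[OF t] by (auto intro!: derivative_eq_intros)
    then have "0 \<le> K t\<^sub>m (p (x\<^sub>m + h) t\<^sub>m) * q (x\<^sub>m + h) t\<^sub>m - K t\<^sub>m (p x\<^sub>m t\<^sub>m) * q x\<^sub>m t\<^sub>m - \<epsilon>"
      by (rule derivative_nonneg_at_left_max[OF _ t]) (use m in auto)
    also have "\<dots> = K t\<^sub>m (p x\<^sub>m t\<^sub>m) * (q (x\<^sub>m + h) t\<^sub>m - q x\<^sub>m t\<^sub>m) - \<epsilon>"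
      using *(1) by (simp add: algebra_simps)
    also have "\<dots> < 0"
      using mult_nonneg_nonpos[OF K[OF t] *(2)] \<epsilon>(1) by (smt (verit))
    finally show False by simp
  qed
  \<comment> \<open>At time 0 the penalty vanishes, so the maximum of \<open>F\<close> is an initial
    difference.\<close>
  then have "F x T \<le> B"
    using m(3)[of T x] init[of x\<^sub>m] \<open>T \<ge> 0\<close> by (simp add: F_def)
  then show "u (x + h) T - u x T \<le> B + e"
    using \<epsilon>(2) by (simp add: F_def)
qed

section \<open>Lipschitz constants and derivatives\<close>

lemma abs_derivative_le_Lipschitz:
  fixes f :: "real \<Rightarrow> real"
  assumes f: "(f has_real_derivative c) (at x)"
    and lip: "\<And>h. \<bar>f (x + h) - f x\<bar> \<le> M * \<bar>h\<bar>"
  shows "\<bar>c\<bar> \<le> M"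
proof -
  have "((\<lambda>h. \<bar>(f (x + h) - f x) / h\<bar>) \<longlongrightarrow> \<bar>c\<bar>) (at 0)"
    using f by (intro tendsto_rabs) (simp add: DERIV_def)
  moreover have "\<forall>\<^sub>F h in at 0. \<bar>(f (x + h) - f x) / h\<bar> \<le> M"
    using lip by (auto simp: eventually_at_filter field_simps abs_divide)
  ultimately show ?thesis
    by (rule tendsto_upperbound) simp
qed

lemma Lipschitz_if_abs_derivative_le:
  fixes f :: "real \<Rightarrow> real"
  assumes f: "\<And>x. (f has_real_derivative f' x) (at x)" and le: "\<And>x. \<bar>f' x\<bar> \<le> M"
  shows "\<bar>f (x + h) - f x\<bar> \<le> M * \<bar>h\<bar>"
  using field_differentiable_bound[of UNIV f f' M x "x + h"] f le by auto

section \<open>Derivatives and suprema of periodic functions\<close>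

text \<open>The derivatives of \<open>f\<close> at \<open>x + 1\<close> are those of its translate
  at \<open>x\<close>, and the translate is \<open>f\<close> itself; so \<open>deriv\<close> selects
  by the same predicate at both points.\<close>

lemma deriv_periodic:
  fixes f :: "real \<Rightarrow> real"
  assumes "periodic_fun_simple' f"
  shows "periodic_fun_simple' (deriv f)"
proof -
  interpret periodic_fun_simple' f by fact
  have "(\<lambda>y. f (y + 1)) = f" using plus_1 by auto
  then show ?thesis
    unfolding deriv_def using DERIV_shift[of f _ _ 1] by unfold_locales simp
qed

text \<open>At integers \<open>frac x = 0\<close> lies outside the open interval; continuity carries
  the bound to the closure. Compactness of \<open>{0..1}\<close> supplies the boundedness without
  which a real \<open>SUP\<close> bounds nothing.\<close>

lemma periodic_le_SUP_open_interval:
  fixes g :: "real \<Rightarrow> real"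
  assumes per: "periodic_fun_simple' g" and cont: "continuous_on UNIV g"
  shows "g x \<le> (SUP y\<in>{0<..<1}. g y)"
proof -
  have "compact (g ` {0..1})"
    by (intro compact_continuous_image continuous_on_subset[OF cont]) auto
  then have "bdd_above (g ` {0..1})"
    by (intro bounded_imp_bdd_above compact_imp_bounded)
  then have bdd: "bdd_above (g ` {0<..<1})"
    by (rule bdd_above_mono) auto
  have "g (frac x) \<le> (SUP y\<in>{0<..<1}. g y)"
  proof (rule continuous_le_on_closure[of "{0<..<1::real}" g])
    show "continuous_on (closure {0<..<1}) g"
      by (rule continuous_on_subset[OF cont]) auto
    show "frac x \<in> closure {0<..<1}"
      using frac_ge_0[of x] frac_lt_1[of x] by auto
    show "g y \<le> (SUP y\<in>{0<..<1}. g y)" if "y \<in> {0<..<1}" for y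
      using that bdd by (rule cSUP_upper)
  qed
  then show ?thesis
    using periodic_eq_frac[OF per, of x] by simp
qed

section \<open>The gradient bound for the system\<close>

theorem theorem4p2:
  fixes \<mu> \<gamma> C\<^sub>1 \<alpha>\<^sub>0 :: real
    and \<sigma> u\<^sub>0 \<alpha> :: "real \<Rightarrow> real"
    and u :: "real \<Rightarrow> real \<Rightarrow> real"
  assumes "\<mu> > 0" and "\<gamma> > 0"
    and "smooth \<sigma>" and "\<And>a. \<sigma> a \<ge> 0"
    and "C\<^sub>1 > 0" and "\<And>a. \<sigma> a \<ge> C\<^sub>1"
    and "solves_system \<mu> \<gamma> \<sigma> u\<^sub>0 \<alpha>\<^sub>0 u \<alpha>"
  shows "\<forall>x\<^sub>0 t\<^sub>0. 0 < x\<^sub>0 \<and> x\<^sub>0 < 1 \<and> t\<^sub>0 > 0 \<longrightarrow>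
    gradient_function u x\<^sub>0 t\<^sub>0 \<le>
      \<sigma> (\<alpha> 0) / C\<^sub>1 * (SUP x\<in>{0<..<1}. (gradient_function u x 0)\<^sup>2)"
proof (intro allI impI)
  fix x\<^sub>0 t\<^sub>0 :: real
  assume "0 < x\<^sub>0 \<and> x\<^sub>0 < 1 \<and> t\<^sub>0 > 0"
  then have "t\<^sub>0 > 0" by simp
  have reg: "classical_regularity u \<alpha>"
    and per: "\<And>t. t \<ge> 0 \<Longrightarrow> periodic_fun_simple' (\<lambda>x. u x t)"
    and pde: "\<And>x t. t > 0 \<Longrightarrow> ddt (u x) t / sqrt (1 + (dx u x t)\<^sup>2) =
        \<mu> * \<sigma> (\<alpha> t) * dx (\<lambda>y s. dx u y s / sqrt (1 + (dx u y s)\<^sup>2)) x t"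
    using assms(7) unfolding solves_system_def by auto
  have cont: "continuous_on (UNIV \<times> {0..}) (\<lambda>(x, t). u x t)"
    using reg unfolding classical_regularity_def by auto
  have ux: "((\<lambda>y. u y t) has_real_derivative dx u x t) (at x)" if "t \<ge> 0" for x t
    using reg that unfolding classical_regularity_def dx_def
    by (simp add: DERIV_deriv_iff_real_differentiable)
  have uxx: "((\<lambda>y. dx u y t) has_real_derivative dx (dx u) x t) (at x)" if "t \<ge> 0" for x t
    using reg that unfolding classical_regularity_def dx_def[of "dx u"]
    by (simp add: DERIV_deriv_iff_real_differentiable)
  \<comment> \<open>The diffusion coefficient once the curvature term is differentiated out and the
    equation is multiplied by \<open>v\<close>.\<close>
  define K where "K t z = \<mu> * \<sigma> (\<alpha> t) / (1 + z\<^sup>2)" for t z :: real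
  have ut: "(u x has_real_derivative K t (dx u x t) * dx (dx u) x t) (at t)" if t: "t > 0" for x t
  proof -
    have "(u x has_vector_derivative ddt (u x) t) (at t within {0..})"
      using reg t unfolding classical_regularity_def ddt_def
      by (simp add: vector_derivative_works)
    \<comment> \<open>For positive times the derivative relative to the half-line is
      two-sided.\<close>
    moreover have "at t within {0..} = at t"
      by (rule at_within_interior) (use t in simp)
    ultimately have der: "(u x has_real_derivative ddt (u x) t) (at t)"
      by (simp add: has_real_derivative_iff_has_vector_derivative)
    define v where "v = sqrt (1 + (dx u x t)\<^sup>2)"
    have "v > 0"
      by (simp add: v_def add_pos_nonneg)
    have "dx (\<lambda>y s. dx u y s / sqrt (1 + (dx u y s)\<^sup>2)) x t = dx (dx u) x t / (v * (1 + (dx u x t)\<^sup>2))"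
      unfolding v_def dx_def[of "\<lambda>y s. dx u y s / sqrt (1 + (dx u y s)\<^sup>2)"]
      by (rule DERIV_imp_deriv[OF curvature_term_derivative[OF uxx]]) (use t in simp)
    with pde[OF t, of x]
    have "ddt (u x) t / v = K t (dx u x t) * dx (dx u) x t / v"
      by (simp add: K_def v_def)
    then have "ddt (u x) t = K t (dx u x t) * dx (dx u) x t"
      using \<open>v > 0\<close> by simp
    with der show ?thesis by simp
  qed
  define S where "S = (SUP x\<in>{0<..<1}. (gradient_function u x 0)\<^sup>2)"
  have v2: "(gradient_function u x t)\<^sup>2 = 1 + (dx u x t)\<^sup>2" for x t
    by (simp add: gradient_function_def)
  have init: "1 + (dx u x 0)\<^sup>2 \<le> S" for x
    unfolding S_def v2
  proof (rule periodic_le_SUP_open_interval)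
    interpret periodic_fun_simple' "\<lambda>x. dx u x 0"
      unfolding dx_def by (rule deriv_periodic[OF per]) simp
    show "periodic_fun_simple' (\<lambda>x. 1 + (dx u x 0)\<^sup>2)"
      by unfold_locales (simp add: plus_1)
    have "continuous_on UNIV (\<lambda>x. dx u x 0)"
      by (intro continuous_at_imp_continuous_on ballI DERIV_isCont[OF uxx]) simp
    then show "continuous_on UNIV (\<lambda>x. 1 + (dx u x 0)\<^sup>2)"
      by (intro continuous_intros)
  qed
  \<comment> \<open>\<open>S - 1\<close> is the supremum of the squared initial slope, so
    \<open>M\<close> is a Lipschitz constant for the initial curve.\<close>
  define M where "M = sqrt (S - 1)"
  have "\<bar>dx u x 0\<bar> \<le> M" for x
    using real_sqrt_le_mono[of "(dx u x 0)\<^sup>2" "S - 1"] init[of x] by (simp add: M_def)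
  then have lip0: "\<bar>u (x + h) 0 - u x 0\<bar> \<le> M * \<bar>h\<bar>" for x h
    using Lipschitz_if_abs_derivative_le[OF ux[of 0]] by simp
  have upper: "u (x + h) t\<^sub>0 - u x t\<^sub>0 \<le> M * \<bar>h\<bar>" for x h
  proof (rule translation_difference_le[where K = K and p = "dx u" and q = "dx (dx u)"])
    show "K t z \<ge> 0" for t z
      using assms(1,4) by (simp add: K_def)
    show "u (y + h) 0 - u y 0 \<le> M * \<bar>h\<bar>" for y
      using lip0[of y h] by linarith
  qed (use cont per ux uxx ut \<open>t\<^sub>0 > 0\<close> in auto)
  \<comment> \<open>The lower bound is the upper one from the base point \<open>x + h\<close> with
    shift \<open>- h\<close>.\<close>
  have "\<bar>u (x + h) t\<^sub>0 - u x t\<^sub>0\<bar> \<le> M * \<bar>h\<bar>" for x h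
    using upper[of x h] upper[of "x + h" "- h"] by simp
  then have "\<bar>dx u x\<^sub>0 t\<^sub>0\<bar> \<le> M"
    using abs_derivative_le_Lipschitz[OF ux] \<open>t\<^sub>0 > 0\<close> by simp
  then have "(dx u x\<^sub>0 t\<^sub>0)\<^sup>2 \<le> M\<^sup>2"
    by (simp add: abs_le_square_iff [symmetric])
  \<comment> \<open>Makes the radicand of \<open>M\<close> nonnegative, so that
    \<open>M\<^sup>2 = S - 1\<close>.\<close>
  moreover have S: "S \<ge> 1"
    using init[of 0] by (smt (verit) zero_le_power2)
  ultimately have "(gradient_function u x\<^sub>0 t\<^sub>0)\<^sup>2 \<le> S"
    by (simp add: v2 M_def)
  moreover have "gradient_function u x\<^sub>0 t\<^sub>0 \<ge> 1"
    by (simp add: gradient_function_def)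
  ultimately have "gradient_function u x\<^sub>0 t\<^sub>0 \<le> S"
    using self_le_power[of "gradient_function u x\<^sub>0 t\<^sub>0" 2] by simp
  also have "\<dots> \<le> \<sigma> (\<alpha> 0) / C\<^sub>1 * S"
    using mult_right_mono[of 1 "\<sigma> (\<alpha> 0) / C\<^sub>1" S] assms(5) assms(6)[of "\<alpha> 0"] S by simp
  finally show "gradient_function u x\<^sub>0 t\<^sub>0 \<le>
      \<sigma> (\<alpha> 0) / C\<^sub>1 * (SUP x\<in>{0<..<1}. (gradient_function u x 0)\<^sup>2)"
    by (simp add: S_def)
qed

end
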